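(* Let $n\geqslant 2$ and let $E\subset\mathbb{R}^n$ be an open weakly $1$-convex set whose $1$-nonconvexity-point set $E^{\triangle}$ is non-empty. Then $E^{\triangle}$ is weakly $1$-convex.
   Context: $\mathbb{R}^n$ carries the Euclidean norm. An open set $G\subset\mathbb{R}^n$ is called weakly $1$-convex if for every point $x\in\partial G$ there exists a straight line $L$ (a $1$-dimensional affine subspace) with $x\in L$ and $L\cap G=\varnothing$. A point $x\in\mathbb{R}^n\setminus E$ is a $1$-nonconvexity point of $E\subset\mathbb{R}^n$ if every straight line passing through $x$ intersects $E$. $E^{\triangle}$ denotes the set of all $1$-nonconvexity points of $E$. For $E$ as in the claim the set $E^{\triangle}$ is open, and its weak $1$-convexity is meant in the sense of open sets just defined. *)

theory Defs
  imports "HOL-Analysis.Analysis"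
begin

definition straight_line :: "'a::euclidean_space set \<Rightarrow> bool"
  where "straight_line L \<longleftrightarrow> affine L \<and> aff_dim L = 1"

text \<open>Weak 1-convexity is a notion for open sets, so openness is part of the definition.\<close>

definition weakly_1_convex :: "'a::euclidean_space set \<Rightarrow> bool"
  where "weakly_1_convex G \<longleftrightarrow>
    open G \<and> (\<forall>x\<in>frontier G. \<exists>L. straight_line L \<and> x \<in> L \<and> L \<inter> G = {})"

definition nonconvexity_point_1 :: "'a::euclidean_space set \<Rightarrow> 'a \<Rightarrow> bool"
  where "nonconvexity_point_1 E x \<longleftrightarrow>
    x \<notin> E \<and> (\<forall>L. straight_line L \<and> x \<in> L \<longrightarrow> L \<inter> E \<noteq> {})"

definition nonconvexity_points_1 :: "'a::euclidean_space set \<Rightarrow> 'a set"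
  where "nonconvexity_points_1 E = {x. nonconvexity_point_1 E x}"

end

theory Submission
  imports Defs
begin

text \<open>A line that misses $E$ consists of points outside $E^{\triangle}$, so it suffices to show that
  $E^{\triangle}$ is open: a frontier point of $E^{\triangle}$ then lies outside $E^{\triangle}$, and
  outside the open set $E$, hence on such a line. Openness follows because, by compactness of the unit
  sphere of directions, the union of all lines missing $E$ is closed; by weak convexity
  it contains the frontier of $E$.\<close>

text \<open>Normalizing the direction makes the lines through a fixed point \<open>x\<close>
  correspond to parameters in the unit sphere, whose compactness the closedness argument
  uses.\<close>

lemma straight_line_iff_unit_direction:
  assumes "x \<in> L"
  shows "straight_line L \<longleftrightarrow> (\<exists>u\<in>sphere 0 1. L = range (\<lambda>t. x + t *\<^sub>R u))"
proof
  assume L: "straight_line L"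
  then have aff: "affine L" "aff_dim L = 1"
    by (auto simp: straight_line_def)
  have "L \<noteq> {x}"
    using aff by auto
  then obtain y where y: "y \<in> L" "y \<noteq> x"
    using assms by blast
  have "affine hull {x, y} \<subseteq> L"
    using aff assms y by (simp add: hull_minimal)
  moreover have "aff_dim (affine hull {x, y}) = aff_dim L"
    using y aff by (simp add: aff_dim_2)
  ultimately have "affine hull {x, y} = L"
    using aff by (intro affine_dim_equal) auto
  then have L_eq: "L = range (\<lambda>t. x + t *\<^sub>R (y - x))"
    by (simp add: affine_hull_2_alt)
  \<comment> \<open>Rescaling the parameter by the nonzero factor \<open>norm (y - x)\<close> leaves
    the line unchanged.\<close>
  have "L = range (\<lambda>t. x + t *\<^sub>R sgn (y - x))"
  proof -
    have "x + t *\<^sub>R (y - x) = x + (t * norm (y - x)) *\<^sub>R sgn (y - x)" for t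
      using y by (simp add: sgn_div_norm)
    moreover have "x + t *\<^sub>R sgn (y - x) = x + (t / norm (y - x)) *\<^sub>R (y - x)" for t
      by (simp add: sgn_div_norm divide_inverse)
    ultimately show ?thesis
      unfolding L_eq by (intro subset_antisym image_subsetI) (blast intro: range_eqI)+
  qed
  moreover have "sgn (y - x) \<in> sphere 0 1"
    using y by (simp add: norm_sgn)
  ultimately show "\<exists>u\<in>sphere 0 1. L = range (\<lambda>t. x + t *\<^sub>R u)"
    by blast
next
  assume "\<exists>u\<in>sphere 0 1. L = range (\<lambda>t. x + t *\<^sub>R u)"
  then obtain u where u: "norm u = 1" "L = range (\<lambda>t. x + t *\<^sub>R u)"
    by auto
  then have "L = affine hull {x, x + u}"
    by (simp add: affine_hull_2_alt)
  moreover have "u \<noteq> 0"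
    using u by auto
  ultimately show "straight_line L"
    by (simp add: straight_line_def aff_dim_2)
qed

text \<open>The set is the projection to the point \<open>x\<close> of a closed set of pairs of
  direction and point, with directions in the compact unit sphere; projecting along a compact factor
  preserves closedness.\<close>

lemma closed_Union_lines_avoiding:
  fixes E :: "'a::euclidean_space set"
  assumes "open E"
  shows "closed {x. \<exists>L. straight_line L \<and> x \<in> L \<and> L \<inter> E = {}}"
proof -
  \<comment> \<open>For each fixed \<open>t\<close>, avoiding the open set \<open>E\<close> at
    \<open>x + t *\<^sub>R u\<close> is a closed condition on \<open>(u, x)\<close>; the restriction
    of \<open>u\<close> to the sphere enters only with the projection.\<close>
  define T where "T = (\<Inter>t. (\<lambda>(u, x). x + t *\<^sub>R u) -` (- E))"
  have "closed T"
    unfolding T_def case_prod_unfold using assms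
    by (intro closed_INT ballI continuous_closed_vimage continuous_intros) auto
  then have "closed {x. \<exists>u. u \<in> sphere 0 1 \<and> (u, x) \<in> T}"
    by (intro closed_compact_projection) auto
  moreover have "(\<exists>u. u \<in> sphere 0 1 \<and> (u, x) \<in> T) \<longleftrightarrow>
      (\<exists>L. straight_line L \<and> x \<in> L \<and> L \<inter> E = {})" (is "?lhs \<longleftrightarrow> ?rhs") for x
  proof
    assume ?lhs
    then obtain u where u: "u \<in> sphere 0 1" "(u, x) \<in> T"
      by blast
    let ?L = "range (\<lambda>t. x + t *\<^sub>R u)"
    have "x \<in> ?L"
      by (rule range_eqI[of _ _ 0]) simp
    moreover from this have "straight_line ?L"
      by (rule straight_line_iff_unit_direction[THEN iffD2]) (rule bexI[OF refl u(1)])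
    moreover have "?L \<inter> E = {}"
      using u by (auto simp: T_def)
    ultimately show ?rhs
      by blast
  next
    assume ?rhs
    then obtain L where L: "straight_line L" "x \<in> L" "L \<inter> E = {}"
      by blast
    from L(2,1) obtain u where "u \<in> sphere 0 1" "L = range (\<lambda>t. x + t *\<^sub>R u)"
      by (rule straight_line_iff_unit_direction[THEN iffD1, THEN bexE])
    with L show ?lhs
      by (auto simp: T_def)
  qed
  ultimately show ?thesis
    by simp
qed

lemma nonconvexity_points_1_eq:
  "nonconvexity_points_1 E = - (E \<union> {x. \<exists>L. straight_line L \<and> x \<in> L \<and> L \<inter> E = {}})"
  by (auto simp: nonconvexity_points_1_def nonconvexity_point_1_def)

text \<open>The complement is \<open>E\<close> together with the closed set of points on lines
  missing \<open>E\<close>. Weak convexity puts the frontier of \<open>E\<close> into the latter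
  set, so \<open>E\<close> may be replaced by its closure.\<close>

lemma open_nonconvexity_points_1:
  assumes "weakly_1_convex E"
  shows "open (nonconvexity_points_1 E)"
proof -
  let ?A = "{x. \<exists>L. straight_line L \<and> x \<in> L \<and> L \<inter> E = {}}"
  have "frontier E \<subseteq> ?A"
    using assms by (auto simp: weakly_1_convex_def)
  then have "E \<union> ?A = closure E \<union> ?A"
    by (auto simp: closure_Un_frontier)
  moreover have "closed (closure E \<union> ?A)"
    using assms by (intro closed_Un closed_Union_lines_avoiding) (auto simp: weakly_1_convex_def)
  ultimately show ?thesis
    by (simp only: nonconvexity_points_1_eq open_Compl)
qed

theorem corollary2:
  fixes E :: "(real ^ 'n) set"
  assumes "CARD('n) \<ge> 2"
    and "open E"
    and "weakly_1_convex E"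
    and "nonconvexity_points_1 E \<noteq> {}"
  shows "weakly_1_convex (nonconvexity_points_1 E)"
  unfolding weakly_1_convex_def
proof (intro conjI ballI)
  show op: "open (nonconvexity_points_1 E)"
    using assms(3) by (rule open_nonconvexity_points_1)
  fix x
  assume "x \<in> frontier (nonconvexity_points_1 E)"
  then have x: "x \<in> closure (nonconvexity_points_1 E)" "x \<notin> nonconvexity_points_1 E"
    using op by (auto simp: frontier_def interior_open)
  \<comment> \<open>This excludes \<open>x \<in> E\<close>, the other way in which \<open>x\<close>
    could fail to be a nonconvexity point.\<close>
  have "E \<inter> closure (nonconvexity_points_1 E) = {}"
    using assms(2) by (subst open_Int_closure_eq_empty) (auto simp: nonconvexity_points_1_eq)
  with x obtain L where "straight_line L" "x \<in> L" "L \<inter> E = {}"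
    by (auto simp: nonconvexity_points_1_eq)
  \<comment> \<open>The same \<open>L\<close> works: it passes through each of its points and misses
    \<open>E\<close>, so none of them is a nonconvexity point.\<close>
  then show "\<exists>L. straight_line L \<and> x \<in> L \<and> L \<inter> nonconvexity_points_1 E = {}"
    by (auto simp: nonconvexity_points_1_eq)
qed

end
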